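(* Let $a\in\mathbb{N}$. Then $f(a,a,2a)=2a-1$.
   Context: $\mathbb{N}$ denotes the positive integers and $[n]=\{1,\dots,n\}$. For $a,b,c\in\mathbb{N}$, $f(a,b,c)$ denotes the metric dimension of the Cartesian product $K_a\times K_b\times K_c$ of complete graphs (vertex set $[a]\times[b]\times[c]$, two triples adjacent iff they differ in exactly one coordinate); the metric dimension of a graph is the minimum size of a vertex set $U$ such that every vertex is uniquely determined by its vector of distances to the vertices of $U$. Equivalently, $f(a,b,c)$ is the minimum cardinality of a set $Q\subseteq[a]\times[b]\times[c]$ such that for all distinct $s,s'$ there is $q\in Q$ with $g(s,q)\neq g(s',q)$, where $g(s,q)$ is the number of indices $i\in[3]$ with $s_i=q_i$. *)

theory Defs
  imports "Graph_Theory.Graph_Theory" "HOL-Library.FuncSet"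
begin

text \<open>
  Undirected graphs are symmetric digraphs. The distance is the shortest-walk cost for unit
  arc weights; it is \<open>\<infinity>\<close> for vertices in different components.
\<close>

definition graph_dist :: "('a, 'b) pre_digraph \<Rightarrow> 'a \<Rightarrow> 'a \<Rightarrow> ereal" where
  "graph_dist G u v = wf_digraph.\<mu> G (\<lambda>_. 1) u v"

definition resolving_set :: "('a, 'b) pre_digraph \<Rightarrow> 'a set \<Rightarrow> bool" where
  "resolving_set G U \<longleftrightarrow>
     U \<subseteq> verts G \<and> inj_on (\<lambda>v. \<lambda>u\<in>U. graph_dist G v u) (verts G)"

text \<open>
  Intended for finite graphs, where the vertex set itself is a finite resolving set,
  so that the minimum is attained.
\<close>

definition metric_dim :: "('a, 'b) pre_digraph \<Rightarrow> nat" where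
  "metric_dim G = (LEAST k. \<exists>U. finite U \<and> resolving_set G U \<and> card U = k)"

definition complete_prod3 :: "nat \<Rightarrow> nat \<Rightarrow> nat \<Rightarrow> (nat \<times> nat \<times> nat) pair_pre_digraph" where
  "complete_prod3 a b c =
     (let V = {1..a} \<times> {1..b} \<times> {1..c} in
      \<lparr> pverts = V,
        parcs = {((x, y, z), (x', y', z')).
                   (x, y, z) \<in> V \<and> (x', y', z') \<in> V \<and>
                   of_bool (x \<noteq> x') + of_bool (y \<noteq> y') + of_bool (z \<noteq> z') = (1::nat)} \<rparr>)"

lemma pair_graph_complete_prod3: "pair_graph (complete_prod3 a b c)"
proof -
  let ?G = "complete_prod3 a b c"
  have sub: "parcs ?G \<subseteq> pverts ?G \<times> pverts ?G"
    by (auto simp: complete_prod3_def Let_def)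
  have fin: "finite (pverts ?G)"
    by (simp add: complete_prod3_def Let_def)
  have sym: "sym (parcs ?G)"
    unfolding complete_prod3_def Let_def sym_def
    by clarsimp
  have irr: "fst e \<noteq> snd e" if "e \<in> parcs ?G" for e
    using that by (auto simp: complete_prod3_def Let_def)
  show ?thesis
    using sub fin sym irr finite_subset[OF sub]
    by unfold_locales (auto simp: symmetric_def)
qed

definition metric_dim_prod3 :: "nat \<Rightarrow> nat \<Rightarrow> nat \<Rightarrow> nat" where
  "metric_dim_prod3 a b c = metric_dim (with_proj (complete_prod3 a b c))"

end

theory Submission
  imports Defs
begin

text \<open>
  The graph distance is the Hamming distance. Two triples differing only in the third coordinate
  cannot be separated unless one of their third coordinates occurs in the resolving set, which
  gives the lower bound. For the upper bound, think of the first two coordinates as the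
  \<open>2a\<close> vertices of a bipartite graph and of a landmark \<open>(x, y, z)\<close> as an edge \<open>xy\<close> labelled \<open>z\<close>;
  the \<open>2a - 1\<close> edges of a Hamiltonian path, with distinct labels, form a resolving set.
\<close>

section \<open>Distances in the product of complete graphs\<close>

fun hamming3 :: "'a \<times> 'b \<times> 'c \<Rightarrow> 'a \<times> 'b \<times> 'c \<Rightarrow> nat" where
  "hamming3 (x, y, z) (x', y', z') =
     of_bool (x \<noteq> x') + of_bool (y \<noteq> y') + of_bool (z \<noteq> z')"

lemma hamming3_triangle: "hamming3 u w \<le> hamming3 u v + hamming3 v w"
  by (cases u; cases v; cases w) auto

lemma verts_complete_prod3:
  "verts (with_proj (complete_prod3 a b c)) = {1..a} \<times> {1..b} \<times> {1..c}"
  by (simp add: complete_prod3_def Let_def)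

lemma arc_complete_prod3_iff:
  "(u, v) \<in> arcs (with_proj (complete_prod3 a b c)) \<longleftrightarrow>
     u \<in> {1..a} \<times> {1..b} \<times> {1..c} \<and> v \<in> {1..a} \<times> {1..b} \<times> {1..c} \<and> hamming3 u v = 1"
  by (cases u; cases v) (simp add: complete_prod3_def Let_def)

text \<open>Each arc changes one coordinate, so by the triangle inequality no walk is shorter than
  the Hamming distance. Correcting the differing coordinates one at a time gives a walk of exactly
  that length.\<close>

lemma graph_dist_complete_prod3:
  assumes u: "u \<in> {1..a} \<times> {1..b} \<times> {1..c}" and v: "v \<in> {1..a} \<times> {1..b} \<times> {1..c}"
  shows "graph_dist (with_proj (complete_prod3 a b c)) u v = hamming3 u v"
proof -
  let ?V = "{1..a} \<times> {1..b} \<times> {1..c}"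
  interpret pair_graph "complete_prod3 a b c" by (rule pair_graph_complete_prod3)
  have cost: "awalk_cost (\<lambda>_. 1) p = real (length p)" for p :: "((nat \<times> nat \<times> nat) \<times> _) list"
    by (induction p) (auto simp: awalk_cost_def)
  have lower: "hamming3 w v \<le> length p" if "awalk w p v" for w p
    using that
  proof (induction p arbitrary: w)
    case Nil
    then show ?case by (cases v) (simp add: awalk_Nil_iff)
  next
    case (Cons e p)
    then have "e \<in> arcs (with_proj (complete_prod3 a b c))" "w = fst e" "awalk (snd e) p v"
      by (simp_all add: awalk_Cons_iff)
    with Cons.IH[of "snd e"] have "hamming3 w (snd e) = 1" "hamming3 (snd e) v \<le> length p"
      using arc_complete_prod3_iff[of "fst e" "snd e" a b c] by auto
    then show ?case using hamming3_triangle[of w v "snd e"] by simp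
  qed
  \<comment> \<open>The witness copies one differing coordinate from \<open>v\<close>, so it stays
    inside the box.\<close>
  have step: "\<exists>w'\<in>?V. hamming3 w w' = 1 \<and> hamming3 w' v = n"
    if wV: "w \<in> ?V" and d: "hamming3 w v = Suc n" for w n
  proof -
    obtain x y z where w: "w = (x, y, z)" by (cases w)
    obtain x' y' z' where v': "v = (x', y', z')" by (cases v)
    consider "x \<noteq> x'" | "x = x'" "y \<noteq> y'" | "x = x'" "y = y'" "z \<noteq> z'"
      using d by (auto simp: w v' of_bool_def split: if_splits)
    then show ?thesis
    proof cases
      case 1
      then show ?thesis using wV v d by (intro bexI[of _ "(x', y, z)"]) (auto simp: w v')
    next
      case 2
      then show ?thesis using wV v d by (intro bexI[of _ "(x, y', z)"]) (auto simp: w v')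
    next
      case 3
      then show ?thesis using wV v d by (intro bexI[of _ "(x, y, z')"]) (auto simp: w v')
    qed
  qed
  have upper: "\<exists>p. awalk w p v \<and> length p = n" if "w \<in> ?V" "hamming3 w v = n" for w n
    using that
  proof (induction n arbitrary: w)
    case 0
    then have "w = v" by (cases w; cases v) (auto simp: of_bool_def split: if_splits)
    then show ?case using v verts_complete_prod3[of a b c] by (auto simp: awalk_Nil_iff)
  next
    case (Suc n)
    obtain w' where w': "w' \<in> ?V" "hamming3 w w' = 1" "hamming3 w' v = n"
      using step[OF Suc.prems] by blast
    obtain p where "awalk w' p v" "length p = n" using Suc.IH w' by blast
    moreover have "(w, w') \<in> arcs (with_proj (complete_prod3 a b c))"
      using Suc.prems w' by (simp only: arc_complete_prod3_iff)
    ultimately show ?case by (intro exI[of _ "(w, w') # p"]) (simp add: awalk_Cons_iff)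
  qed
  obtain p where p: "awalk u p v" "length p = hamming3 u v" using upper u by blast
  have "\<mu> (\<lambda>_. 1) u v = hamming3 u v"
  proof (rule antisym)
    show "\<mu> (\<lambda>_. 1) u v \<le> hamming3 u v"
      using min_cost_le_walk_cost[OF p(1), of "\<lambda>_. 1"] p(2) by (simp add: cost)
    show "hamming3 u v \<le> \<mu> (\<lambda>_. 1) u v"
      unfolding \<mu>_def by (rule INF_greatest) (use lower in \<open>simp add: cost\<close>)
  qed
  then show ?thesis by (simp add: graph_dist_def)
qed

section \<open>Resolving sets in Hamming terms and the lower bound\<close>

lemma restrict_eq_iff: "restrict f A = restrict g A \<longleftrightarrow> (\<forall>x\<in>A. f x = g x)"
  by (auto simp: restrict_def fun_eq_iff)

lemma resolving_set_complete_prod3_iff: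
  "resolving_set (with_proj (complete_prod3 a b c)) U \<longleftrightarrow>
     U \<subseteq> {1..a} \<times> {1..b} \<times> {1..c} \<and>
     (\<forall>s \<in> {1..a} \<times> {1..b} \<times> {1..c}. \<forall>t \<in> {1..a} \<times> {1..b} \<times> {1..c}.
        (\<forall>q \<in> U. hamming3 s q = hamming3 t q) \<longrightarrow> s = t)"
proof (cases "U \<subseteq> {1..a} \<times> {1..b} \<times> {1..c}")
  case True
  let ?V = "{1..a} \<times> {1..b} \<times> {1..c}"
  let ?d = "graph_dist (with_proj (complete_prod3 a b c))"
  have "restrict (?d s) U = restrict (?d t) U \<longleftrightarrow> (\<forall>q\<in>U. hamming3 s q = hamming3 t q)"
    if st: "s \<in> ?V" "t \<in> ?V" for s t
  proof -
    have "?d s q = ?d t q \<longleftrightarrow> hamming3 s q = hamming3 t q" if "q \<in> U" for q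
    proof -
      have "q \<in> ?V" using True that by blast
      then show ?thesis using st by (simp only: graph_dist_complete_prod3) simp
    qed
    then show ?thesis by (simp add: restrict_eq_iff)
  qed
  then show ?thesis
    using True by (simp only: resolving_set_def inj_on_def verts_complete_prod3 cong: ball_cong)
qed (simp only: resolving_set_def verts_complete_prod3 simp_thms)

text \<open>At most one value in \<open>{1..c}\<close> can be missing from the third coordinates of
  \<open>U\<close>, and each element of \<open>U\<close> supplies only one value.\<close>

lemma card_resolving_set_complete_prod3_ge:
  assumes res: "resolving_set (with_proj (complete_prod3 a b c)) U"
    and fin: "finite U" and "a \<ge> 1" "b \<ge> 1"
  shows "c - 1 \<le> card U"
proof -
  let ?Z = "(snd \<circ> snd) ` U"
  have "z = z'" if z: "z \<in> {1..c} - ?Z" "z' \<in> {1..c} - ?Z" for z z'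
  proof -
    \<comment> \<open>Neither \<open>z\<close> nor \<open>z'\<close> is a third coordinate in
      \<open>U\<close>, so the last summand is 1 on both sides.\<close>
    have "hamming3 (1, 1, z) q = hamming3 (1, 1, z') q" if "q \<in> U" for q
      using z that by (cases q) (force simp: image_iff)
    moreover have "(1, 1, z) \<in> {1..a} \<times> {1..b} \<times> {1..c}" "(1, 1, z') \<in> {1..a} \<times> {1..b} \<times> {1..c}"
      using z assms by auto
    ultimately have "(1::nat, 1::nat, z) = (1, 1, z')"
      using res unfolding resolving_set_complete_prod3_iff by blast
    then show ?thesis by simp
  qed
  then have "card ({1..c} - ?Z) \<le> 1"
    by (auto simp: card_le_Suc0_iff_eq)
  moreover have "card {1..c} - card ?Z \<le> card ({1..c} - ?Z)"
    using fin by (intro diff_card_le_card_Diff) simp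
  moreover have "card ?Z \<le> card U" by (rule card_image_le[OF fin])
  ultimately show ?thesis by simp
qed

section \<open>The Hamiltonian path as a resolving set\<close>

lemma hamming3_eq_3_iff: "hamming3 (x, y, z) (x', y', z') = 3 \<longleftrightarrow> x \<noteq> x' \<and> y \<noteq> y' \<and> z \<noteq> z'"
  by simp

text \<open>The path runs through row 1, column 1, row 2, column 2, up to row \<open>a\<close>,
  column \<open>a\<close>, with edges labelled in order. Row \<open>x\<close> carries the labels
  \<open>2 * x - 2\<close> (if \<open>x > 1\<close>) and \<open>2 * x - 1\<close>; column
  \<open>y\<close> carries \<open>2 * y - 1\<close> and \<open>2 * y\<close> (if
  \<open>y < a\<close>).\<close>

lemma staircase_separates:
  fixes a x y z x' y' z' :: nat
  assumes range: "1 \<le> x" "x \<le> a" "1 \<le> y" "y \<le> a" "1 \<le> x'" "x' \<le> a" "1 \<le> y'" "y' \<le> a"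
    and odd: "\<And>k. 1 \<le> k \<Longrightarrow> k \<le> a \<Longrightarrow>
      hamming3 (x, y, z) (k, k, 2 * k - 1) = hamming3 (x', y', z') (k, k, 2 * k - 1)"
    and even: "\<And>k. 1 \<le> k \<Longrightarrow> k < a \<Longrightarrow>
      hamming3 (x, y, z) (k + 1, k, 2 * k) = hamming3 (x', y', z') (k + 1, k, 2 * k)"
  shows "x = x' \<and> y = y'"
proof (rule ccontr)
  have odd_edge: "of_bool (x \<noteq> k) + of_bool (y \<noteq> k) + of_bool (z \<noteq> 2 * k - 1) =
      of_bool (x' \<noteq> k) + of_bool (y' \<noteq> k) + (of_bool (z' \<noteq> 2 * k - 1) :: nat)"
    if "1 \<le> k" "k \<le> a" for k
    using odd[OF that] by (simp only: hamming3.simps)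
  have even_col: "of_bool (x \<noteq> k + 1) + of_bool (y \<noteq> k) + of_bool (z \<noteq> 2 * k) =
      of_bool (x' \<noteq> k + 1) + of_bool (y' \<noteq> k) + (of_bool (z' \<noteq> 2 * k) :: nat)"
    if "1 \<le> k" "k < a" for k
    using even[OF that] by (simp only: hamming3.simps)
  \<comment> \<open>The even edges again, now indexed by their row instead of their column;
    \<open>1 < k\<close> keeps the subtraction exact.\<close>
  have even_row: "hamming3 (x, y, z) (k, k - 1, 2 * (k - 1)) =
      hamming3 (x', y', z') (k, k - 1, 2 * (k - 1))"
    if "1 < k" "k \<le> a" for k
    using even[of "k - 1"] that by (simp del: hamming3.simps)
  assume "\<not> ?thesis"
  then consider "x = x'" "y \<noteq> y'" | "x \<noteq> x'" "y = y'" | "x \<noteq> x'" "y \<noteq> y'" by blast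
  then show False
  proof cases
    case 1
    \<comment> \<open>At an edge in column \<open>y\<close> only the first triple matches the
      column, so \<open>z'\<close> must make up for it by equalling the label; symmetrically for
      \<open>y'\<close> and \<open>z\<close>. One of the two columns is below \<open>a\<close> and
      so forces two different labels.\<close>
    have "z' = 2 * y - 1" "z = 2 * y' - 1"
      using odd_edge[of y] odd_edge[of y'] range 1 by (auto simp: of_bool_def split: if_splits)
    moreover have "y < a \<Longrightarrow> z' = 2 * y" "y' < a \<Longrightarrow> z = 2 * y'"
      using even_col[of y] even_col[of y'] range 1 by (auto simp: of_bool_def split: if_splits)
    ultimately show False using range 1 by linarith
  next
    case 2
    have "z' = 2 * x - 1" "z = 2 * x' - 1"
      using odd_edge[of x] odd_edge[of x'] range 2 by (auto simp: of_bool_def split: if_splits)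
    moreover have "z' = 2 * (x - 1)" if "x > 1"
      using even_row[OF that range(2)] 2 by (auto simp: of_bool_def split: if_splits)
    moreover have "z = 2 * (x' - 1)" if "x' > 1"
      using even_row[OF that range(6)] 2 by (auto simp: of_bool_def split: if_splits)
    ultimately show False using range 2 by linarith
  next
    case 3
    \<comment> \<open>If \<open>xy\<close> were an edge of the path, its landmark would be within
      distance 1 of the first triple but at least 2 from the second. Hence no edge at
      \<open>x\<close> is also an edge at \<open>y\<close>.\<close>
    have off: "x \<noteq> y" "x' \<noteq> y'"
      using odd_edge[of y] odd_edge[of y'] range 3 by (auto simp: of_bool_def split: if_splits)
    have off': "x \<noteq> y + 1" "x' \<noteq> y' + 1"
      using even_col[of y] even_col[of y'] range 3 by (auto simp: of_bool_def split: if_splits)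
    \<comment> \<open>A landmark edge at \<open>x\<close> is at distance below 3 from the first
      triple, so the second triple must also match it somewhere. The facts \<open>o1\<close> to
      \<open>o4\<close> treat the odd edges in this way, \<open>e1\<close> to \<open>e4\<close> the
      even ones.\<close>
    have o1: "y' = x \<or> z' = 2 * x - 1"
      using arg_cong[OF odd[OF range(1,2)], of "\<lambda>n. n = 3"] 3
      unfolding hamming3_eq_3_iff by blast
    have o2: "x' = y \<or> z' = 2 * y - 1"
      using arg_cong[OF odd[OF range(3,4)], of "\<lambda>n. n = 3"] 3
      unfolding hamming3_eq_3_iff by blast
    have o3: "y = x' \<or> z = 2 * x' - 1"
      using arg_cong[OF odd[OF range(5,6)], of "\<lambda>n. n = 3"] 3
      unfolding hamming3_eq_3_iff by blast
    have o4: "x = y' \<or> z = 2 * y' - 1"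
      using arg_cong[OF odd[OF range(7,8)], of "\<lambda>n. n = 3"] 3
      unfolding hamming3_eq_3_iff by blast
    have e1: "y' = x - 1 \<or> z' = 2 * (x - 1)" if "x > 1"
      using arg_cong[OF even_row[OF that range(2)], of "\<lambda>n. n = 3"] 3
      unfolding hamming3_eq_3_iff by blast
    have e2: "x' = y + 1 \<or> z' = 2 * y" if "y < a"
      using arg_cong[OF even[OF range(3) that], of "\<lambda>n. n = 3"] 3
      unfolding hamming3_eq_3_iff by blast
    have e3: "y = x' - 1 \<or> z = 2 * (x' - 1)" if "x' > 1"
      using arg_cong[OF even_row[OF that range(6)], of "\<lambda>n. n = 3"] 3
      unfolding hamming3_eq_3_iff by blast
    have e4: "x = y' + 1 \<or> z = 2 * y'" if "y' < a"
      using arg_cong[OF even[OF range(7) that], of "\<lambda>n. n = 3"] 3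
      unfolding hamming3_eq_3_iff by blast
    \<comment> \<open>Each of the up to four edges at \<open>x\<close> and \<open>y\<close> must meet \<open>x'\<close> or \<open>y'\<close> or carry the label \<open>z'\<close>,
      which accounts for at most three of them.\<close>
    have "x = 1 \<or> y = a"
    proof (rule ccontr)
      assume "\<not> ?thesis"
      then have "x > 1" "y < a" using range by auto
      with o1 o2 e1 e2 have "z' = 2 * x - 1 \<or> z' = 2 * (x - 1)" "z' = 2 * y - 1 \<or> z' = 2 * y"
        by auto
      then show False using off(1) off'(1) \<open>x > 1\<close> range(3) by (elim disjE; presburger)
    qed
    moreover have "x' = 1 \<or> y' = a"
    proof (rule ccontr)
      assume "\<not> ?thesis"
      then have "x' > 1" "y' < a" using range by auto
      with o3 o4 e3 e4 have "z = 2 * x' - 1 \<or> z = 2 * (x' - 1)" "z = 2 * y' - 1 \<or> z = 2 * y'"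
        by auto
      then show False using off(2) off'(2) \<open>x' > 1\<close> range(7) by (elim disjE; presburger)
    qed
    \<comment> \<open>The triples differ in both row and column, so they cannot share the path end
      row 1 or the path end column \<open>a\<close>: each has exactly one of them.\<close>
    ultimately consider "x = 1" "y' = a" | "x' = 1" "y = a" using 3 by blast
    then show False
    proof cases
      case 1
      \<comment> \<open>The only edge at row 1 forces \<open>z' = 1\<close>. Neither edge at column
        \<open>y\<close> has label 1, so both would have to end in row \<open>x'\<close>.\<close>
      with o1 range 3 have "z' = 1" by auto
      with o2 1 off range have "x' = y" by auto
      then show False using e2 \<open>z' = 1\<close> 1 range 3 by auto
    next
      case 2
      with o3 range 3 have "z = 1" by auto
      with o4 2 off range have "x = y'" by auto
      then show False using e4 \<open>z = 1\<close> 2 range 3 by auto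
    qed
  qed
qed

text \<open>The index \<open>i\<close> enumerates the path: \<open>i = 2 * k - 1\<close> gives row
  \<open>k\<close>, column \<open>k\<close>, and \<open>i = 2 * k\<close> gives row
  \<open>k + 1\<close>, column \<open>k\<close>.\<close>

lemma resolving_set_staircase:
  fixes a :: nat
  assumes "a \<ge> 1"
  shows "resolving_set (with_proj (complete_prod3 a a (2 * a)))
           ((\<lambda>i. (i div 2 + 1, (i + 1) div 2, i)) ` {1..2 * a - 1})"
    (is "resolving_set _ ?U")
proof -
  let ?V = "{1..a} \<times> {1..a} \<times> {1..2 * a}"
  have odd_mem: "(k, k, 2 * k - 1) \<in> ?U" if "1 \<le> k" "k \<le> a" for k
    using that by (intro image_eqI[of _ _ "2 * k - 1"]) auto
  have even_mem: "(k + 1, k, 2 * k) \<in> ?U" if "1 \<le> k" "k < a" for k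
    using that by (intro image_eqI[of _ _ "2 * k"]) auto
  have "\<forall>s\<in>?V. \<forall>t\<in>?V. (\<forall>q\<in>?U. hamming3 s q = hamming3 t q) \<longrightarrow> s = t"
  proof (intro ballI impI)
    fix s t
    assume st: "s \<in> ?V" "t \<in> ?V" and same: "\<forall>q\<in>?U. hamming3 s q = hamming3 t q"
    obtain x y z where s: "s = (x, y, z)" by (cases s)
    obtain x' y' z' where t: "t = (x', y', z')" by (cases t)
    have xy: "x = x' \<and> y = y'"
    proof (rule staircase_separates[of x a y x' y' z z'])
      show "hamming3 (x, y, z) (k, k, 2 * k - 1) = hamming3 (x', y', z') (k, k, 2 * k - 1)"
        if "1 \<le> k" "k \<le> a" for k
        using bspec[OF same odd_mem[OF that]] by (simp only: s t)
      show "hamming3 (x, y, z) (k + 1, k, 2 * k) = hamming3 (x', y', z') (k + 1, k, 2 * k)"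
        if "1 \<le> k" "k < a" for k
        using bspec[OF same even_mem[OF that]] by (simp only: s t)
    qed (use st in \<open>auto simp: s t\<close>)
    \<comment> \<open>With equal rows and columns, landmark \<open>i\<close> only tests whether the
      third coordinate is \<open>i\<close>. The sole value without a landmark is
      \<open>2 * a\<close>.\<close>
    have "z = i \<longleftrightarrow> z' = i" if "i \<in> {1..2 * a - 1}" for i
      using bspec[OF same imageI[OF that]] xy by (auto simp: s t of_bool_def split: if_splits)
    then have "z = z' \<or> z \<notin> {1..2 * a - 1} \<and> z' \<notin> {1..2 * a - 1}" by blast
    moreover have "1 \<le> z" "z \<le> 2 * a" "1 \<le> z'" "z' \<le> 2 * a" using st by (simp_all add: s t)
    ultimately have "z = z'" by auto
    then show "s = t" using xy by (simp add: s t)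
  qed
  moreover have "?U \<subseteq> ?V" by auto
  ultimately show ?thesis
    by (simp only: resolving_set_complete_prod3_iff)
qed

theorem theorem3:
  fixes a :: nat
  assumes "a \<ge> 1"
  shows "metric_dim_prod3 a a (2 * a) = 2 * a - 1"
  unfolding metric_dim_prod3_def metric_dim_def
proof (rule Least_equality)
  let ?U = "(\<lambda>i. (i div 2 + 1, (i + 1) div 2, i)) ` {1..2 * a - 1}"
  \<comment> \<open>The label is the index itself, so the map is injective.\<close>
  have "card ?U = 2 * a - 1"
    by (subst card_image) (auto simp: inj_on_def)
  then show "\<exists>U. finite U \<and> resolving_set (with_proj (complete_prod3 a a (2 * a))) U \<and>
      card U = 2 * a - 1"
    using resolving_set_staircase[OF assms] by (intro exI[of _ ?U]) simp
next
  fix k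
  assume "\<exists>U. finite U \<and> resolving_set (with_proj (complete_prod3 a a (2 * a))) U \<and> card U = k"
  then show "2 * a - 1 \<le> k"
    using card_resolving_set_complete_prod3_ge[OF _ _ assms assms] by auto
qed

end
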